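(* Let $G$ be a graph whose complement $\overline{G}$ has no induced cycle of length four. Then $G$ contains a strong immersion of $K_{\chi(G)}$.
   Context: All graphs are finite and simple (no loops, no parallel edges). $K_t$ denotes the complete graph on $t$ vertices and $\chi(G)$ the chromatic number of $G$. A graph $G$ contains an immersion of a graph $H$ if there is an injective function $\phi:V(H)\to V(G)$ such that: (1) for every edge $uv\in E(H)$ there is a path $P_{uv}$ in $G$ connecting $\phi(u)$ and $\phi(v)$; (2) the paths $\{P_{uv}: uv\in E(H)\}$ are pairwise edge-disjoint. The immersion is strong if moreover the paths $P_{uv}$ are internally disjoint from $\phi(V(H))$, i.e. no internal vertex of any $P_{uv}$ lies in $\phi(V(H))$. *)

theory Defs
  imports "Graph_Theory.Graph_Theory"
begin

text \<open>Finite simple graphs are \<^locale>\<open>pair_graph\<close>s: an undirected edge \<open>uv\<close> is the pair of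
  mutually inverse arcs \<open>(u, v)\<close> and \<open>(v, u)\<close>.\<close>

definition graph_complement :: "'a pair_pre_digraph \<Rightarrow> 'a pair_pre_digraph" where
  "graph_complement G =
    \<lparr> pverts = pverts G,
      parcs = {(u, v). u \<in> pverts G \<and> v \<in> pverts G \<and> u \<noteq> v \<and> (u, v) \<notin> parcs G} \<rparr>"

definition complete_graph :: "nat \<Rightarrow> nat pair_pre_digraph" where
  "complete_graph t = \<lparr> pverts = {..<t}, parcs = {(u, v). u < t \<and> v < t \<and> u \<noteq> v} \<rparr>"

definition proper_coloring :: "'a pair_pre_digraph \<Rightarrow> nat \<Rightarrow> ('a \<Rightarrow> nat) \<Rightarrow> bool" where
  "proper_coloring G k c \<longleftrightarrow>
    c ` pverts G \<subseteq> {..<k} \<and> (\<forall>(u, v) \<in> parcs G. c u \<noteq> c v)"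

definition chromatic_number :: "'a pair_pre_digraph \<Rightarrow> nat" where
  "chromatic_number G = (LEAST k. \<exists>c. proper_coloring G k c)"

text \<open>A cycle is given by the list of its vertices in cyclic order; it is induced if the only
  edges among its vertices are those between cyclically consecutive ones.\<close>

definition induced_cycle :: "'a pair_pre_digraph \<Rightarrow> 'a list \<Rightarrow> bool" where
  "induced_cycle G c \<longleftrightarrow>
    3 \<le> length c \<and> distinct c \<and> set c \<subseteq> pverts G \<and>
    (\<forall>i < length c. \<forall>j < length c.
      (c ! i, c ! j) \<in> parcs G \<longleftrightarrow> j = Suc i mod length c \<or> i = Suc j mod length c)"

text \<open>Edge-disjointness concerns undirected edges, so a path must not use \<open>(u, v)\<close> when another
  one uses \<open>(v, u)\<close>; hence the edges traversed are recorded as unordered pairs.\<close>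

definition path_edges :: "'a list \<Rightarrow> 'a set set" where
  "path_edges p = (\<lambda>(u, v). {u, v}) ` set (vwalk_arcs p)"

definition graph_edges :: "'a pair_pre_digraph \<Rightarrow> 'a set set" where
  "graph_edges G = (\<lambda>(u, v). {u, v}) ` parcs G"

definition internal_verts :: "'a list \<Rightarrow> 'a set" where
  "internal_verts p = set (butlast (tl p))"

text \<open>The paths are indexed by the undirected edges of \<open>H\<close>, one path for each edge.\<close>

definition is_immersion ::
  "'b pair_pre_digraph \<Rightarrow> 'a pair_pre_digraph \<Rightarrow> ('b \<Rightarrow> 'a) \<Rightarrow> ('b set \<Rightarrow> 'a list) \<Rightarrow> bool" where
  "is_immersion H G \<phi> P \<longleftrightarrow>
    inj_on \<phi> (pverts H) \<and> \<phi> ` pverts H \<subseteq> pverts G \<and>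
    (\<forall>e \<in> graph_edges H. vpath (P e) (with_proj G) \<and> {hd (P e), last (P e)} = \<phi> ` e) \<and>
    (\<forall>e \<in> graph_edges H. \<forall>f \<in> graph_edges H.
      e \<noteq> f \<longrightarrow> path_edges (P e) \<inter> path_edges (P f) = {})"

definition contains_strong_immersion ::
  "'a pair_pre_digraph \<Rightarrow> 'b pair_pre_digraph \<Rightarrow> bool" where
  "contains_strong_immersion G H \<longleftrightarrow>
    (\<exists>\<phi> P. is_immersion H G \<phi> P \<and>
      (\<forall>e \<in> graph_edges H. internal_verts (P e) \<inter> \<phi> ` pverts H = {}))"

lemma pair_graph_graph_complement:
  assumes "pair_graph G"
  shows "pair_graph (graph_complement G)"
proof -
  interpret pair_graph G by fact
  have "finite {(u, v). u \<in> pverts G \<and> v \<in> pverts G \<and> u \<noteq> v \<and> (u, v) \<notin> parcs G}"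
    by (rule finite_subset[of _ "pverts G \<times> pverts G"]) auto
  then show ?thesis
    by unfold_locales
      (auto simp: graph_complement_def symmetric_def sym_def arcs_ends_conv
            intro: arcs_symmetric)
qed

lemma K_complete_graph: "K\<^bsub>t\<^esub> (with_proj (complete_graph t))"
proof -
  have "finite {(u, v). u < t \<and> v < t \<and> u \<noteq> v}"
    by (rule finite_subset[of _ "{..<t} \<times> {..<t}"]) auto
  then have "pair_graph (complete_graph t)"
    by unfold_locales (auto simp: complete_graph_def symmetric_def sym_def arcs_ends_conv)
  then have "graph (with_proj (complete_graph t))"
    by (rule pair_graph.pair_graphD_graph)
  then show ?thesis
    by (auto simp: complete_digraph_def complete_graph_def)
qed

lemma proper_coloring_chromatic_number:
  assumes "pair_graph G"
  shows "\<exists>c. proper_coloring G (chromatic_number G) c"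
proof -
  interpret pair_graph G by fact
  obtain c :: "'a \<Rightarrow> nat" where c: "c ` pverts G = {..<card (pverts G)}" "inj_on c (pverts G)"
    using ex_bij_betw_finite_nat[OF pair_finite_verts]
    by (auto simp: bij_betw_def atLeast0LessThan)
  have "proper_coloring G (card (pverts G)) c"
    unfolding proper_coloring_def
  proof safe
    fix u v assume uv: "(u, v) \<in> parcs G" and "c u = c v"
    then have "u = v"
      using c(2) by (auto dest: inj_onD in_arcsD1 in_arcsD2)
    with pair_no_loops[OF uv] show False by simp
  qed (use c in auto)
  then show ?thesis
    unfolding chromatic_number_def by (intro LeastI[where P = "\<lambda>k. \<exists>c. proper_coloring G k c"]) blast
qed

end

theory Submission
  imports Defs
begin

text \<open>
  The branch vertices and paths come from an arbitrary optimal colouring. In a colouring with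
  \<open>\<chi>(G)\<close> colours each class \<open>i\<close> contains a vertex \<open>v\<^sub>i\<close> that has neighbours in all the other
  classes, since otherwise the class could be dissolved into them (\<open>chromatic_number_b_vertex\<close>).
  These vertices are the branch vertices.

  An induced four-cycle of the complement is a pair of edges of \<open>G\<close> with no edge between them. If
  there is no such pair, then the vertices of two colours \<open>i\<close> and \<open>j\<close> induce a bipartite graph in
  which all edges lie in one component, and this component contains \<open>v\<^sub>i\<close> and \<open>v\<^sub>j\<close>. They are
  therefore joined by a Kempe chain, which can even be taken to have length one or three
  (\<open>two_coloured_path\<close>). A Kempe chain determines its two colours from any of its edges, so chains
  for different pairs of colours are edge-disjoint; and since \<open>v\<^sub>i\<close> is the only branch vertex
  of colour \<open>i\<close>, no branch vertex is internal to a chain.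
\<close>

lemma chromatic_number_le:
  assumes "proper_coloring G k c"
  shows "chromatic_number G \<le> k"
  unfolding chromatic_number_def using assms by (blast intro: Least_le)

text \<open>If every vertex of class \<open>i\<close> has no neighbour in some other class, then all of them can be recoloured
  at once, because the class is independent; this empties the class.\<close>

lemma chromatic_number_b_vertex:
  assumes "pair_graph G" and c: "proper_coloring G (chromatic_number G) c"
    and i: "i < chromatic_number G"
  shows "\<exists>v \<in> pverts G. c v = i \<and>
    (\<forall>j < chromatic_number G. j \<noteq> i \<longrightarrow> (\<exists>w. (v, w) \<in> parcs G \<and> c w = j))"
proof (rule ccontr)
  interpret pair_graph G by fact
  let ?k = "chromatic_number G"
  assume "\<not> ?thesis"
  then have "\<forall>v \<in> {v \<in> pverts G. c v = i}. \<exists>j. j < ?k \<and> j \<noteq> i \<and> (\<forall>w. (v, w) \<in> parcs G \<longrightarrow> c w \<noteq> j)"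
    by blast
  from bchoice[OF this] obtain f where f: "\<And>v. v \<in> pverts G \<Longrightarrow> c v = i \<Longrightarrow>
      f v < ?k \<and> f v \<noteq> i \<and> (\<forall>w. (v, w) \<in> parcs G \<longrightarrow> c w \<noteq> f v)"
    by blast
  define d where "d v = (if c v = i then f v else c v)" for v
  have d_range: "d v < ?k" "d v \<noteq> i" if "v \<in> pverts G" for v
    using that f c by (auto simp: d_def proper_coloring_def)
  have d_proper: "d u \<noteq> d v" if uv: "(u, v) \<in> parcs G" for u v
  proof -
    have "c u \<noteq> c v" using c uv by (auto simp: proper_coloring_def)
    moreover have "u \<in> pverts G" "v \<in> pverts G" "(v, u) \<in> parcs G"
      using uv by (auto intro: arcs_symmetric dest: in_arcsD1 in_arcsD2)
    ultimately show ?thesis using f[of u] f[of v] uv by (auto simp: d_def)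
  qed
  \<comment> \<open>Colour \<open>i\<close> is now free, and renaming the last colour to \<open>i\<close> leaves only colours below \<open>?k - 1\<close>.\<close>
  define r where "r x = (if x = ?k - 1 then i else x)" for x
  have "proper_coloring G (?k - 1) (r \<circ> d)"
    unfolding proper_coloring_def
  proof safe
    fix v assume "v \<in> pverts G"
    then show "(r \<circ> d) v < ?k - 1"
      using d_range[of v] i by (auto simp: r_def)
  next
    fix u v assume uv: "(u, v) \<in> parcs G" and eq: "(r \<circ> d) u = (r \<circ> d) v"
    have "d u \<noteq> i" "d v \<noteq> i"
      using uv d_range by (auto dest: in_arcsD1 in_arcsD2)
    then show False
      using eq d_proper[OF uv] by (auto simp: r_def split: if_splits)
  qed
  then have "?k \<le> ?k - 1" by (rule chromatic_number_le)
  with i show False by simp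
qed

text \<open>Two edges \<open>ab\<close> and \<open>cd\<close> with no edge between them would give the induced cycle
  \<open>a c b d\<close> of the complement.\<close>

lemma edge_between_edges:
  assumes "pair_graph G"
    and C4: "\<not> (\<exists>c. induced_cycle (graph_complement G) c \<and> length c = 4)"
    and ab: "(a, b) \<in> parcs G" and cd: "(c, d) \<in> parcs G"
  shows "(a, c) \<in> parcs G \<or> (a, d) \<in> parcs G \<or> (b, c) \<in> parcs G \<or> (b, d) \<in> parcs G"
proof (rule ccontr)
  interpret pair_graph G by fact
  assume no: "\<not> ?thesis"
  have V: "a \<in> pverts G" "b \<in> pverts G" "c \<in> pverts G" "d \<in> pverts G"
    using ab cd by (auto dest: in_arcsD1 in_arcsD2)
  have sym: "(u, v) \<in> parcs G \<Longrightarrow> (v, u) \<in> parcs G" for u v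
    by (rule arcs_symmetric)
  have noloop: "(u, u) \<notin> parcs G" for u
    using pair_no_loops[of "(u, u)"] by auto
  have ne: "a \<noteq> b" "c \<noteq> d" "a \<noteq> c" "a \<noteq> d" "b \<noteq> c" "b \<noteq> d"
    using no ab cd noloop sym[OF ab] sym[OF cd] by auto
  have no': "(a, c) \<notin> parcs G" "(a, d) \<notin> parcs G" "(b, c) \<notin> parcs G" "(b, d) \<notin> parcs G"
      "(c, a) \<notin> parcs G" "(d, a) \<notin> parcs G" "(c, b) \<notin> parcs G" "(d, b) \<notin> parcs G"
    using no sym[of c a] sym[of d a] sym[of c b] sym[of d b] by auto
  have all4: "(\<forall>i < length [a, c, b, d]. Q i) \<longleftrightarrow> Q 0 \<and> Q 1 \<and> Q 2 \<and> Q 3" for Q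
    by (auto simp: numeral_eq_Suc less_Suc_eq)
  have "induced_cycle (graph_complement G) [a, c, b, d]"
    unfolding induced_cycle_def graph_complement_def all4
    using V ne ne[symmetric] no' ab cd sym[OF ab] sym[OF cd] by simp
  moreover have "length [a, c, b, d] = 4" by simp
  ultimately show False using C4 by blast
qed

text \<open>If \<open>u\<close> and \<open>v\<close> are not adjacent, neighbours \<open>x\<close> of \<open>u\<close> and \<open>y\<close> of \<open>v\<close> in the colours of \<open>v\<close>
  and \<open>u\<close> must be adjacent: some edge joins \<open>ux\<close> to \<open>yv\<close>, and the colouring excludes \<open>uy\<close> and
  \<open>xv\<close>. The path is then \<open>u x y v\<close>.\<close>

lemma two_coloured_path:
  assumes "pair_graph G"
    and C4: "\<not> (\<exists>c. induced_cycle (graph_complement G) c \<and> length c = 4)"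
    and c: "proper_coloring G k c"
    and V: "u \<in> pverts G" "v \<in> pverts G" and uv: "c u \<noteq> c v"
    and ux: "(u, x) \<in> parcs G" "c x = c v"
    and vy: "(v, y) \<in> parcs G" "c y = c u"
  shows "\<exists>p. vpath p (with_proj G) \<and> hd p = u \<and> last p = v \<and>
    (\<forall>e \<in> path_edges p. c ` e = {c u, c v}) \<and>
    internal_verts p \<subseteq> {w. c w \<in> {c u, c v}} - {u, v}"
proof (cases "(u, v) \<in> parcs G")
  case True
  have "vpath [u, v] (with_proj G)"
    using True V uv by (auto simp: vpath_def vwalk_def arcs_ends_conv)
  then show ?thesis
    by (intro exI[of _ "[u, v]"]) (auto simp: path_edges_def internal_verts_def)
next
  case False
  interpret pair_graph G by fact
  have sym: "(s, t) \<in> parcs G \<Longrightarrow> (t, s) \<in> parcs G" for s t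
    by (rule arcs_symmetric)
  have neq: "c s \<noteq> c t" if "(s, t) \<in> parcs G" for s t
    using c that by (auto simp: proper_coloring_def)
  have xy: "(x, y) \<in> parcs G"
    using edge_between_edges[OF assms(1) C4 ux(1) sym[OF vy(1)]] False
      neq[of u y] neq[of x v] ux(2) vy(2) by auto
  have "x \<noteq> v" "y \<noteq> u" using False ux(1) vy(1) sym by blast+
  moreover have "vpath [u, x, y, v] (with_proj G)"
    using calculation ux vy xy uv V sym[OF vy(1)]
    by (auto simp: vpath_def vwalk_def arcs_ends_conv dest: in_arcsD1 in_arcsD2)
  ultimately show ?thesis
    using ux(2) vy(2) uv
    by (intro exI[of _ "[u, x, y, v]"]) (auto simp: path_edges_def internal_verts_def)
qed

theorem theorem1p4:
  fixes G :: "'a pair_pre_digraph"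
  assumes "pair_graph G"
    and "\<not> (\<exists>c. induced_cycle (graph_complement G) c \<and> length c = 4)"
  shows "contains_strong_immersion G (complete_graph (chromatic_number G))"
proof -
  let ?k = "chromatic_number G"
  let ?K = "complete_graph ?k"
  have verts_K: "pverts ?K = {..<?k}"
    by (simp add: complete_graph_def)
  obtain c where c: "proper_coloring G ?k c"
    using proper_coloring_chromatic_number[OF assms(1)] by blast
  obtain \<phi> where \<phi>: "\<And>i. i < ?k \<Longrightarrow> \<phi> i \<in> pverts G" "\<And>i. i < ?k \<Longrightarrow> c (\<phi> i) = i"
    and nb: "\<And>i j. i < ?k \<Longrightarrow> j < ?k \<Longrightarrow> j \<noteq> i \<Longrightarrow> \<exists>w. (\<phi> i, w) \<in> parcs G \<and> c w = j"
    using chromatic_number_b_vertex[OF assms(1) c] by metis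
  have "\<exists>p. vpath p (with_proj G) \<and> {hd p, last p} = \<phi> ` e \<and>
      (\<forall>f \<in> path_edges p. c ` f = e) \<and> internal_verts p \<inter> \<phi> ` {..<?k} = {}"
    if "e \<in> graph_edges ?K" for e
  proof -
    from that obtain i j where ij: "i < ?k" "j < ?k" "i \<noteq> j" and e: "e = {i, j}"
      by (auto simp: graph_edges_def complete_graph_def)
    obtain x where x: "(\<phi> i, x) \<in> parcs G" "c x = j" using nb[of i j] ij by auto
    obtain y where y: "(\<phi> j, y) \<in> parcs G" "c y = i" using nb[of j i] ij by auto
    obtain p where p: "vpath p (with_proj G)" "hd p = \<phi> i" "last p = \<phi> j"
        "\<forall>f \<in> path_edges p. c ` f = {i, j}"
        "internal_verts p \<subseteq> {w. c w \<in> {i, j}} - {\<phi> i, \<phi> j}"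
      using two_coloured_path[OF assms c \<phi>(1)[OF ij(1)] \<phi>(1)[OF ij(2)], of x y]
        ij x y \<phi>(2) by auto
    have "internal_verts p \<inter> \<phi> ` {..<?k} = {}"
      using p(5) \<phi>(2) by fastforce
    with p e show ?thesis by auto
  qed
  then obtain P where P: "\<And>e. e \<in> graph_edges ?K \<Longrightarrow>
      vpath (P e) (with_proj G) \<and> {hd (P e), last (P e)} = \<phi> ` e \<and>
      (\<forall>f \<in> path_edges (P e). c ` f = e) \<and> internal_verts (P e) \<inter> \<phi> ` {..<?k} = {}"
    by metis
  have "inj_on \<phi> {..<?k}"
    using \<phi>(2) by (auto intro: inj_on_inverseI[of _ c])
  moreover have "path_edges (P e) \<inter> path_edges (P f) = {}"
    if "e \<in> graph_edges ?K" "f \<in> graph_edges ?K" "e \<noteq> f" for e f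
  proof (rule equals0I)
    fix g assume "g \<in> path_edges (P e) \<inter> path_edges (P f)"
    then have "c ` g = e" "c ` g = f"
      using P[OF that(1)] P[OF that(2)] by auto
    with that(3) show False by simp
  qed
  ultimately have "is_immersion ?K G \<phi> P"
    unfolding is_immersion_def verts_K using P \<phi>(1) by (simp add: image_subset_iff)
  then show ?thesis
    unfolding contains_strong_immersion_def verts_K
    by (intro exI[of _ \<phi>] exI[of _ P] conjI ballI) (simp_all add: P)
qed

end
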